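(* Let $\widetilde{\mathcal{L}}$ be any submodule of $\mathbb{Z}^n$ having rank $n$. Then there exists a sandpile graph (on $n+1$ vertices, the nonsink vertices being identified with $\{1,\dots,n\}$) whose reduced Laplacian lattice is $\widetilde{\mathcal{L}}$. Every lattice ideal defining a finite set of points is the lattice ideal associated with the reduced Laplacian of some sandpile graph.
   Context: A directed multigraph $G=(V,E)$ has a finite vertex set $V$ and edge set $E\subseteq V\times V$ with a weight function $\mathrm{wt}:V\times V\to\mathbb{N}$, $\mathrm{wt}(u,v)>0$ iff $(u,v)\in E$ (loops allowed); $\mathrm{outdeg}(v)=\sum_{u\in V}\mathrm{wt}(v,u)$. A sandpile graph $(V,E,s)$ is a directed multigraph with a vertex $s$ (the sink) that is globally accessible: from every vertex there is a directed path to $s$. Write $\widetilde V=V\setminus\{s\}$. The reduced Laplacian is $\widetilde\Delta:\mathbb{Z}\widetilde V\to\mathbb{Z}\widetilde V$, $\widetilde\Delta(v)=\mathrm{outdeg}(v)\,v-\sum_{u\in\widetilde V}\mathrm{wt}(v,u)\,u$; the reduced Laplacian lattice is $\mathrm{im}(\widetilde\Delta)$, and the lattice ideal associated with the reduced Laplacian is the lattice ideal of this image. For a submodule $\Lambda\subseteq\mathbb{Z}^n$, the lattice ideal is $I(\Lambda)=\mathrm{Span}_{\mathbb{C}}\{x^u-x^v: u,v\in\mathbb{N}^n,\ u-v\in\Lambda\}\subseteq\mathbb{C}[x_1,\dots,x_n]$; it defines a finite set of points if its zero set in $\mathbb{C}^n$ is finite. *)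

theory Defs
  imports Complex_Main "HOL-Library.Poly_Mapping" "HOL-Library.FuncSet"
begin

section \<open>Free abelian groups, submodules and rank\<close>

text \<open>
  Elements of the free \<open>\<int>\<close>-module on a set are finitely supported functions
  \<^typ>\<open>'a \<Rightarrow>\<^sub>0 int\<close>, with basis vectors \<^term>\<open>frag_of v\<close> and scalar multiplication
  \<^const>\<open>frag_cmul\<close>. The interpretation provides \<open>zmod.subspace\<close> (submodule) and
  \<open>zmod.independent\<close> (linear independence over \<open>\<int>\<close>).
\<close>

interpretation zmod: module "frag_cmul :: int \<Rightarrow> ('a \<Rightarrow>\<^sub>0 int) \<Rightarrow> 'a \<Rightarrow>\<^sub>0 int"
  by unfold_locales (simp_all add: frag_cmul_distrib frag_cmul_distrib2)

text \<open>\<open>free_zmod {1..n}\<close> is \<open>\<int>\<^sup>n\<close>; it is the zero module for \<open>n = 0\<close>.\<close>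

definition free_zmod :: "'a set \<Rightarrow> ('a \<Rightarrow>\<^sub>0 int) set" where
  "free_zmod X = {x. Poly_Mapping.keys x \<subseteq> X}"

definition submodule_of :: "('a \<Rightarrow>\<^sub>0 int) set \<Rightarrow> ('a \<Rightarrow>\<^sub>0 int) set \<Rightarrow> bool" where
  "submodule_of L M \<longleftrightarrow> zmod.subspace L \<and> L \<subseteq> M"

text \<open>The rank is the largest number of \<open>\<int>\<close>-linearly independent elements.\<close>

definition has_rank :: "('a \<Rightarrow>\<^sub>0 int) set \<Rightarrow> nat \<Rightarrow> bool" where
  "has_rank L r \<longleftrightarrow>
     (\<exists>B\<subseteq>L. finite B \<and> zmod.independent B \<and> card B = r) \<and>
     (\<forall>B\<subseteq>L. finite B \<and> zmod.independent B \<longrightarrow> card B \<le> r)"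


section \<open>Sandpile graphs and the reduced Laplacian\<close>

text \<open>The values of the weight function outside \<open>V \<times> V\<close> are irrelevant.\<close>

locale directed_multigraph =
  fixes V :: "'a set" and E :: "('a \<times> 'a) set" and wt :: "'a \<Rightarrow> 'a \<Rightarrow> nat"
  assumes finite_V: "finite V"
    and edges_subset: "E \<subseteq> V \<times> V"
    and wt_pos_iff: "\<lbrakk>u \<in> V; v \<in> V\<rbrakk> \<Longrightarrow> wt u v > 0 \<longleftrightarrow> (u, v) \<in> E"

locale sandpile_graph = directed_multigraph V E wt
  for V :: "'a set" and E :: "('a \<times> 'a) set" and wt :: "'a \<Rightarrow> 'a \<Rightarrow> nat" +
  fixes s :: 'a
  assumes sink_in_V: "s \<in> V"
    and sink_accessible: "v \<in> V \<Longrightarrow> (v, s) \<in> E\<^sup>*"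

definition outdeg :: "'a set \<Rightarrow> ('a \<Rightarrow> 'a \<Rightarrow> nat) \<Rightarrow> 'a \<Rightarrow> nat" where
  "outdeg V wt v = (\<Sum>u\<in>V. wt v u)"

text \<open>\<^const>\<open>frag_extend\<close> is the \<open>\<int>\<close>-linear extension of a map given on basis vectors.\<close>

definition reduced_laplacian ::
    "'a set \<Rightarrow> ('a \<Rightarrow> 'a \<Rightarrow> nat) \<Rightarrow> 'a \<Rightarrow> ('a \<Rightarrow>\<^sub>0 int) \<Rightarrow> ('a \<Rightarrow>\<^sub>0 int)" where
  "reduced_laplacian V wt s =
     frag_extend (\<lambda>v. frag_cmul (int (outdeg V wt v)) (frag_of v)
                      - (\<Sum>u\<in>V - {s}. frag_cmul (int (wt v u)) (frag_of u)))"

definition reduced_laplacian_lattice ::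
    "'a set \<Rightarrow> ('a \<Rightarrow> 'a \<Rightarrow> nat) \<Rightarrow> 'a \<Rightarrow> ('a \<Rightarrow>\<^sub>0 int) set" where
  "reduced_laplacian_lattice V wt s = reduced_laplacian V wt s ` free_zmod (V - {s})"


section \<open>Lattice ideals and their zero sets\<close>

text \<open>
  Complex polynomials in variables indexed by \<^typ>\<open>'a\<close> are finitely supported functions from
  exponent vectors to coefficients. The polynomial ring in the variables \<open>X\<close> consists of those
  polynomials all of whose exponent vectors are supported in \<open>X\<close>.
\<close>

type_synonym 'a cpoly = "('a \<Rightarrow>\<^sub>0 nat) \<Rightarrow>\<^sub>0 complex"

definition monomial :: "('a \<Rightarrow>\<^sub>0 nat) \<Rightarrow> 'a cpoly" where
  "monomial u = Poly_Mapping.single u 1"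

definition cpoly_scale :: "complex \<Rightarrow> 'a cpoly \<Rightarrow> 'a cpoly" where
  "cpoly_scale c p = Poly_Mapping.map ((*) c) p"

lemma lookup_cpoly_scale [simp]:
  "Poly_Mapping.lookup (cpoly_scale c p) u = c * Poly_Mapping.lookup p u"
  by (simp add: cpoly_scale_def Poly_Mapping.map.rep_eq when_def)

interpretation cpoly: vector_space "cpoly_scale :: complex \<Rightarrow> 'a cpoly \<Rightarrow> 'a cpoly"
  by unfold_locales (simp_all add: poly_mapping_eqI lookup_add algebra_simps)

definition int_exponent :: "('a \<Rightarrow>\<^sub>0 nat) \<Rightarrow> ('a \<Rightarrow>\<^sub>0 int)" where
  "int_exponent u = Poly_Mapping.map int u"

definition lattice_ideal :: "'a set \<Rightarrow> ('a \<Rightarrow>\<^sub>0 int) set \<Rightarrow> 'a cpoly set" where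
  "lattice_ideal X L =
     cpoly.span {monomial u - monomial v | u v.
       Poly_Mapping.keys u \<subseteq> X \<and> Poly_Mapping.keys v \<subseteq> X \<and>
       int_exponent u - int_exponent v \<in> L}"

definition eval_cpoly :: "('a \<Rightarrow> complex) \<Rightarrow> 'a cpoly \<Rightarrow> complex" where
  "eval_cpoly z p =
     (\<Sum>u\<in>Poly_Mapping.keys p. Poly_Mapping.lookup p u *
        (\<Prod>i\<in>Poly_Mapping.keys u. z i ^ Poly_Mapping.lookup u i))"

text \<open>
  Points of \<open>\<complex>\<^sup>X\<close> are extensional functions on \<open>X\<close>, so that finiteness of the zero set is not
  affected by values at indices outside \<open>X\<close>.
\<close>

definition zero_set :: "'a set \<Rightarrow> 'a cpoly set \<Rightarrow> ('a \<Rightarrow> complex) set" where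
  "zero_set X I = {z \<in> X \<rightarrow>\<^sub>E UNIV. \<forall>p\<in>I. eval_cpoly z p = 0}"

end

theory Submission
  imports Defs "HOL-Library.Function_Algebras"
begin

text \<open>
  Both halves of the theorem reduce to one construction. Let \<open>X\<close> be a finite set and \<open>L\<close> a
  submodule of \<open>\<int>\<^sup>X\<close> that contains a positive multiple of every basis vector. Then \<open>L\<close> is the
  reduced Laplacian lattice of a sandpile graph on \<open>X\<close> and a sink \<open>s\<close>
  (\<open>exists_sandpile_graph_with_lattice\<close>). What has to be found are generators \<open>b\<^sub>v\<close> of \<open>L\<close>, one for
  each \<open>v \<in> X\<close>, whose entries off \<open>v\<close> are \<open>\<le> 0\<close> and whose coordinate sums are \<open>\<ge> 0\<close>: such a
  family is the same thing as the rows of a reduced Laplacian, the coordinate sum of \<open>b\<^sub>v\<close> being the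
  weight of the edge from \<open>v\<close> to the sink.

  The generators come by induction on \<open>X\<close>. Choose \<open>a \<in> X\<close> and put \<open>Y = X - {a}\<close>. The vectors of \<open>L\<close>
  with coordinate sum \<open>0\<close> are determined by their coordinates in \<open>Y\<close>, so they form a
  submodule of \<open>\<int>\<^sup>Y\<close>, which again contains multiples of the basis vectors. By induction it comes
  from a sandpile graph on \<open>X\<close> whose sink is \<open>a\<close>. Read in \<open>\<int>\<^sup>X\<close>, where \<open>a\<close> is an ordinary vertex,
  its rows get coordinate sum \<open>0\<close>, that is, no edges to the new sink. These rows generate
  the part of \<open>L\<close> of coordinate sum \<open>0\<close>, so adding any \<open>b \<in> L\<close> whose coordinate sum \<open>c > 0\<close> is the
  least possible gives generators of \<open>L\<close>. To make \<open>b\<close> a legal row for \<open>a\<close>, subtract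
  from it a large vector of \<open>L\<close> with coordinate sum \<open>0\<close> that is positive on \<open>Y\<close>
  (\<open>exists_nonpositive_off_diagonal\<close>). In the new graph \<open>a\<close> has \<open>c\<close> edges to \<open>s\<close>, and
  every vertex reaches \<open>s\<close> through \<open>a\<close>.

  It remains to see that multiples of the basis vectors lie in \<open>L\<close>. If \<open>L\<close> has rank \<open>card X\<close>, this is
  a dimension count over the rationals (\<open>torsion_of_has_rank\<close>). If no positive multiple of the
  basis vector at \<open>v\<close> lies in \<open>L\<close>, then there is a rational linear functional \<open>f\<close> that vanishes on \<open>L\<close>
  but not on that vector, and the points \<open>(exp (t * f\<^sub>i))\<^sub>i\<close> for real \<open>t\<close> are infinitely many zeros
  of the lattice ideal (\<open>torsion_of_finite_zero_set\<close>). Thus for a zero-dimensional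
  lattice ideal a graph exists that realizes the lattice itself, hence also the ideal.
\<close>

section \<open>Elements of free modules\<close>

(* As simplification rules, zmod.scale_minus_left and minus_frag_cmul undo each other. *)
declare minus_frag_cmul [simp del]

lemma free_zmod_subspace: "zmod.subspace (free_zmod X)"
  unfolding zmod.subspace_def free_zmod_def
  using Poly_Mapping.keys_add by fastforce

lemma frag_of_in_free_zmod: "v \<in> X \<Longrightarrow> frag_of v \<in> free_zmod X"
  by (simp add: free_zmod_def)

lemma free_zmod_expansion:
  assumes "finite X" "x \<in> free_zmod X"
  shows "x = (\<Sum>v\<in>X. frag_cmul (Poly_Mapping.lookup x v) (frag_of v))"
proof -
  have "x = (\<Sum>v\<in>Poly_Mapping.keys x. frag_cmul (Poly_Mapping.lookup x v) (frag_of v))"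
    using frag_expansion[of x] by (simp add: frag_extend_def)
  also have "\<dots> = (\<Sum>v\<in>X. frag_cmul (Poly_Mapping.lookup x v) (frag_of v))"
    using assms by (intro sum.mono_neutral_left) (auto simp: free_zmod_def in_keys_iff)
  finally show ?thesis .
qed

lemma frag_extend_mem:
  assumes "zmod.subspace L" "\<And>v. v \<in> Poly_Mapping.keys x \<Longrightarrow> f v \<in> L"
  shows "frag_extend f x \<in> L"
  unfolding frag_extend_def
  using assms by (intro zmod.subspace_sum zmod.subspace_scale) auto

lemma frag_extend_frag_extend:
  "frag_extend f (frag_extend g x) = frag_extend (\<lambda>v. frag_extend f (g v)) x"
  unfolding frag_extend_def[of g] frag_extend_def[of "\<lambda>v. frag_extend f (g v)"]
  by (simp add: frag_extend_sum frag_extend_cmul o_def)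

text \<open>
  The values of \<open>h\<close> on \<open>L\<close> form a subgroup of \<open>\<int>\<close>, which is generated by its least positive element.
\<close>

lemma integral_functional_generator:
  fixes h :: "('a \<Rightarrow>\<^sub>0 int) \<Rightarrow> int"
  assumes L: "zmod.subspace L"
    and diff: "\<And>x y. h (x - y) = h x - h y"
    and scale: "\<And>k x. h (frag_cmul k x) = k * h x"
    and pos: "x0 \<in> L" "h x0 > 0"
  obtains w where "w \<in> L" "h w > 0" "\<And>x. x \<in> L \<Longrightarrow> h w dvd h x"
proof -
  define P where "P = (\<lambda>k. k > 0 \<and> (\<exists>x\<in>L. h x = int k))"
  have "P (nat (h x0))"
    using pos by (auto simp: P_def)
  define k where "k = (LEAST k. P k)"
  have "P k"
    unfolding k_def by (rule LeastI) fact
  then obtain w where w: "w \<in> L" "h w = int k" and "k > 0"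
    by (auto simp: P_def)
  have "h w dvd h x" if "x \<in> L" for x
  proof (rule ccontr)
    assume "\<not> h w dvd h x"
    then have r: "h x mod h w > 0" "h x mod h w < int k"
      using \<open>k > 0\<close> pos_mod_sign[of "h w" "h x"] pos_mod_bound[of "h w" "h x"]
      unfolding w(2) dvd_eq_mod_eq_0 by linarith+
    define y where "y = x - frag_cmul (h x div h w) w"
    have "y \<in> L"
      unfolding y_def using L that w by (intro zmod.subspace_diff zmod.subspace_scale)
    moreover have "h y = h x mod h w"
      by (simp add: y_def diff scale minus_div_mult_eq_mod)
    ultimately have "P (nat (h x mod h w))"
      using r unfolding P_def by (intro conjI bexI[of _ y]) auto
    then have "k \<le> nat (h x mod h w)"
      unfolding k_def by (rule Least_le)
    then show False
      using r by linarith
  qed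
  with w \<open>k > 0\<close> show ?thesis
    using that[of w] by simp
qed

section \<open>Sandpile graphs with prescribed lattice\<close>

text \<open>
  Every path to the old sink \<open>a\<close> is continued by the edge from \<open>a\<close> to \<open>s\<close>. The old graph may also
  have edges out of \<open>a\<close>, about which the new graph says nothing, so the path has to be cut at the
  first visit to \<open>a\<close>.
\<close>

lemma sandpile_graph_add_sink:
  assumes G: "sandpile_graph (insert a Y) E wt a"
    and "0 < c"
    and wt_Y: "\<And>v u. v \<in> Y \<Longrightarrow> u \<in> insert a Y \<Longrightarrow> wt' v u = wt v u"
    and wt_a: "wt' a s = c"
  shows "sandpile_graph (insert s (insert a Y))
     {(u, v) \<in> insert s (insert a Y) \<times> insert s (insert a Y). 0 < wt' u v} wt' s"
    (is "sandpile_graph ?V ?E _ _")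
proof -
  interpret sandpile_graph "insert a Y" E wt a by fact
  have reach: "(v, s) \<in> ?E\<^sup>*" if "(v, a) \<in> E\<^sup>*" for v
    using that
  proof (induction rule: converse_rtrancl_induct)
    case base
    show ?case using wt_a \<open>0 < c\<close> by auto
  next
    case (step v u)
    show ?case
    proof (cases "v = a")
      case True
      then show ?thesis using wt_a \<open>0 < c\<close> by auto
    next
      case False
      with step.hyps(1) edges_subset have "v \<in> Y" "u \<in> insert a Y"
        by auto
      then have "(v, u) \<in> ?E"
        using step.hyps(1) wt_pos_iff[of v u] wt_Y[of v u] by auto
      with step.IH show ?thesis
        by (rule converse_rtrancl_into_rtrancl[rotated])
    qed
  qed
  show ?thesis
  proof unfold_locales
    show "finite ?V" using finite_V by simp
    show "?E \<subseteq> ?V \<times> ?V" by blast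
    show "0 < wt' u v \<longleftrightarrow> (u, v) \<in> ?E" if "u \<in> ?V" "v \<in> ?V" for u v
      using that by auto
    show "s \<in> ?V" by simp
    show "(v, s) \<in> ?E\<^sup>*" if "v \<in> ?V" for v
      using that reach sink_accessible[of v] by blast
  qed
qed

text \<open>
  Subtracting multiples of \<open>e\<^sub>v - e\<^sub>a\<close> lowers the coordinate at \<open>v\<close> without changing the coordinate
  sum, and sufficiently divisible multiples stay in \<open>L\<close>.
\<close>

lemma exists_nonpositive_off_diagonal:
  assumes "finite Y" "a \<notin> Y" "zmod.subspace L"
    and tors: "\<And>v. v \<in> insert a Y \<Longrightarrow> \<exists>N>0. frag_cmul N (frag_of v) \<in> L"
    and w: "w \<in> L"
  obtains b where "b \<in> L"
    "(\<Sum>v\<in>insert a Y. Poly_Mapping.lookup b v) = (\<Sum>v\<in>insert a Y. Poly_Mapping.lookup w v)"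
    "\<And>v. v \<in> Y \<Longrightarrow> Poly_Mapping.lookup b v \<le> 0"
proof -
  obtain N where N: "\<And>v. v \<in> insert a Y \<Longrightarrow> N v > 0 \<and> frag_cmul (N v) (frag_of v) \<in> L"
    using tors by metis
  have *: "frag_cmul (k * N v) (frag_of v) \<in> L" if "v \<in> insert a Y" for v k
    using zmod.subspace_scale[OF \<open>zmod.subspace L\<close>, of "frag_cmul (N v) (frag_of v)" k] N[OF that]
    by simp
  \<comment> \<open>The factor \<open>N a * N v\<close> makes both \<open>M v * e\<^sub>v\<close> and \<open>M v * e\<^sub>a\<close> lie in \<open>L\<close>; as it is at least \<open>1\<close>, also
    \<open>M v \<ge> w\<^sub>v\<close>.\<close>
  define M where "M = (\<lambda>v. \<bar>Poly_Mapping.lookup w v\<bar> * N a * N v)"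
  define q where "q = (\<Sum>v\<in>Y. frag_cmul (M v) (frag_of v) - frag_cmul (M v) (frag_of a))"
  have "q \<in> L"
    unfolding q_def
  proof (intro zmod.subspace_sum zmod.subspace_diff \<open>zmod.subspace L\<close>)
    fix v assume "v \<in> Y"
    then show "frag_cmul (M v) (frag_of v) \<in> L" "frag_cmul (M v) (frag_of a) \<in> L"
      using *[of v "\<bar>Poly_Mapping.lookup w v\<bar> * N a"] *[of a "\<bar>Poly_Mapping.lookup w v\<bar> * N v"]
      by (auto simp: M_def mult_ac)
  qed
  have q: "Poly_Mapping.lookup q u = (\<Sum>v\<in>Y. M v * ((if u = v then 1 else 0) - (if u = a then 1 else 0)))" for u
    by (simp add: q_def lookup_sum lookup_minus algebra_simps)
  have qY: "Poly_Mapping.lookup q u = M u" if "u \<in> Y" for u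
  proof -
    have "Poly_Mapping.lookup q u = (\<Sum>v\<in>Y. if u = v then M v else 0)"
      using that assms(2) by (subst q) (auto intro!: sum.cong)
    then show ?thesis
      using that assms(1) by simp
  qed
  have qa: "Poly_Mapping.lookup q a = - (\<Sum>v\<in>Y. M v)"
    using assms(1,2) by (subst q) (auto simp: sum_negf[symmetric] intro!: sum.cong)
  show ?thesis
  proof (rule that[of "w - q"])
    show "w - q \<in> L"
      using w \<open>q \<in> L\<close> \<open>zmod.subspace L\<close> by (intro zmod.subspace_diff)
    show "(\<Sum>v\<in>insert a Y. Poly_Mapping.lookup (w - q) v) = (\<Sum>v\<in>insert a Y. Poly_Mapping.lookup w v)"
      using assms(1,2) by (simp add: lookup_minus sum_subtractf qY qa)
    show "Poly_Mapping.lookup (w - q) v \<le> 0" if "v \<in> Y" for v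
    proof -
      have "1 \<le> N a * N v"
        using N[of a] N[of v] that mult_pos_pos[of "N a" "N v"]
        by (metis insertCI int_one_le_iff_zero_less)
      then have "\<bar>Poly_Mapping.lookup w v\<bar> * 1 \<le> \<bar>Poly_Mapping.lookup w v\<bar> * (N a * N v)"
        by (intro mult_left_mono) auto
      then show ?thesis
        using that by (simp add: lookup_minus qY M_def mult_ac)
    qed
  qed
qed

text \<open>
  The map \<open>y \<mapsto> \<Sum>v. y\<^sub>v (e\<^sub>v - e\<^sub>a)\<close> identifies \<open>\<int>\<^sup>Y\<close> with the vectors of coordinate sum \<open>0\<close>, and carries
  the row of \<open>v \<in> Y\<close> for the sink \<open>a\<close> to the row of \<open>v\<close> for the sink \<open>s\<close>: the entry at \<open>a\<close> which the
  old row drops is recovered from the coordinate sum. The row of \<open>a\<close> is \<open>b\<close>. Any \<open>x \<in> L\<close> becomes a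
  vector of coordinate sum \<open>0\<close> after subtracting a multiple of \<open>b\<close>, and so is a combination of rows.
\<close>

lemma lattice_add_sink:
  fixes Y :: "'a set"
  assumes fin: "finite Y" and "a \<notin> Y" and s: "s \<notin> insert a Y"
    and L: "zmod.subspace L" "L \<subseteq> free_zmod (insert a Y)"
    and old: "reduced_laplacian_lattice (insert a Y) wt a =
        {y \<in> free_zmod Y. frag_extend (\<lambda>v. frag_of v - frag_of a) y \<in> L}"
    and b: "b \<in> L" "\<And>v. v \<in> Y \<Longrightarrow> Poly_Mapping.lookup b v \<le> 0"
    and c: "(\<Sum>v\<in>insert a Y. Poly_Mapping.lookup b v) = int c"
    and c_dvd: "\<And>x. x \<in> L \<Longrightarrow> int c dvd (\<Sum>v\<in>insert a Y. Poly_Mapping.lookup x v)"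
    and wt_Y: "\<And>v u. v \<in> Y \<Longrightarrow> u \<in> insert a Y \<Longrightarrow> wt' v u = wt v u"
    and wt_Y_s: "\<And>v. v \<in> Y \<Longrightarrow> wt' v s = 0"
    and wt_a: "wt' a s = c" "wt' a a = 0"
      "\<And>u. u \<in> Y \<Longrightarrow> wt' a u = nat (- Poly_Mapping.lookup b u)"
  shows "reduced_laplacian_lattice (insert s (insert a Y)) wt' s = L"
proof -
  define \<phi> where "\<phi> = frag_extend (\<lambda>v. frag_of v - frag_of a)"
  define row0 where "row0 = (\<lambda>v. frag_cmul (int (outdeg (insert a Y) wt v)) (frag_of v)
                      - (\<Sum>u\<in>Y. frag_cmul (int (wt v u)) (frag_of u)))"
  define row where "row = (\<lambda>v. frag_cmul (int (outdeg (insert s (insert a Y)) wt' v)) (frag_of v)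
                      - (\<Sum>u\<in>insert a Y. frag_cmul (int (wt' v u)) (frag_of u)))"
  have minus: "insert a Y - {a} = Y" "insert s (insert a Y) - {s} = insert a Y"
    using \<open>a \<notin> Y\<close> s by auto
  have lat0: "reduced_laplacian_lattice (insert a Y) wt a = frag_extend row0 ` free_zmod Y"
    unfolding reduced_laplacian_lattice_def reduced_laplacian_def minus row0_def ..
  have lat: "reduced_laplacian_lattice (insert s (insert a Y)) wt' s
      = frag_extend row ` free_zmod (insert a Y)"
    unfolding reduced_laplacian_lattice_def reduced_laplacian_def minus row_def ..
  have row_a: "row a = b"
  proof -
    have "(\<Sum>u\<in>Y. int (wt' a u)) = - (\<Sum>u\<in>Y. Poly_Mapping.lookup b u)"
      unfolding sum_negf[symmetric] using b wt_a by (intro sum.cong) auto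
    then have out: "int (outdeg (insert s (insert a Y)) wt' a) = Poly_Mapping.lookup b a"
      using fin \<open>a \<notin> Y\<close> s c wt_a by (simp add: outdeg_def)
    have neg: "(\<Sum>u\<in>Y. frag_cmul (int (wt' a u)) (frag_of u))
        = - (\<Sum>u\<in>Y. frag_cmul (Poly_Mapping.lookup b u) (frag_of u))"
      unfolding sum_negf[symmetric] using b wt_a by (intro sum.cong) auto
    have "row a = (\<Sum>v\<in>insert a Y. frag_cmul (Poly_Mapping.lookup b v) (frag_of v))"
      using fin \<open>a \<notin> Y\<close> wt_a(2) by (simp add: row_def out neg)
    also have "\<dots> = b"
      using fin b L by (intro free_zmod_expansion[symmetric]) auto
    finally show ?thesis .
  qed
  have row_Y: "row v = \<phi> (row0 v)" if "v \<in> Y" for v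
  proof -
    have out: "outdeg (insert s (insert a Y)) wt' v = outdeg (insert a Y) wt v"
      unfolding outdeg_def using fin s that wt_Y wt_Y_s by (auto intro!: sum.cong)
    have "\<phi> (row0 v) = frag_cmul (int (outdeg (insert a Y) wt v)) (frag_of v - frag_of a)
        - (\<Sum>u\<in>Y. frag_cmul (int (wt v u)) (frag_of u - frag_of a))"
      using fin by (simp add: \<phi>_def row0_def frag_extend_diff frag_extend_sum frag_extend_cmul o_def)
    also have "(\<Sum>u\<in>Y. frag_cmul (int (wt v u)) (frag_of u - frag_of a))
        = (\<Sum>u\<in>Y. frag_cmul (int (wt v u)) (frag_of u)) - frag_cmul (\<Sum>u\<in>Y. int (wt v u)) (frag_of a)"
      by (simp add: zmod.scale_right_diff_distrib sum_subtractf zmod.scale_sum_left)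
    also have "(\<Sum>u\<in>Y. int (wt v u)) = int (outdeg (insert a Y) wt v) - int (wt v a)"
      using fin \<open>a \<notin> Y\<close> by (simp add: outdeg_def)
    also have "(\<Sum>u\<in>Y. frag_cmul (int (wt v u)) (frag_of u))
        = (\<Sum>u\<in>insert a Y. frag_cmul (int (wt' v u)) (frag_of u)) - frag_cmul (int (wt v a)) (frag_of a)"
      using fin \<open>a \<notin> Y\<close> that wt_Y by simp
    finally show ?thesis
      by (simp add: row_def out zmod.scale_right_diff_distrib zmod.scale_left_diff_distrib)
  qed
  have row_extend: "frag_extend row p = \<phi> (frag_extend row0 p)" if "p \<in> free_zmod Y" for p
  proof -
    have "frag_extend row p = frag_extend (\<lambda>v. \<phi> (row0 v)) p"
      using that row_Y by (intro frag_extend_eq) (auto simp: free_zmod_def)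
    then show ?thesis
      by (simp add: \<phi>_def frag_extend_frag_extend)
  qed
  have old': "frag_extend row0 ` free_zmod Y = {y \<in> free_zmod Y. \<phi> y \<in> L}"
    using old by (simp add: lat0 \<phi>_def)
  show ?thesis
  proof (intro equalityI subsetI)
    fix x assume "x \<in> reduced_laplacian_lattice (insert s (insert a Y)) wt' s"
    then obtain p where p: "p \<in> free_zmod (insert a Y)" "x = frag_extend row p"
      by (auto simp: lat)
    have "row v \<in> L" if "v \<in> insert a Y" for v
    proof (cases "v = a")
      case True
      then show ?thesis using b row_a by simp
    next
      case False
      then have "v \<in> Y" using that by simp
      then have "frag_extend row0 (frag_of v) \<in> frag_extend row0 ` free_zmod Y"
        by (intro imageI frag_of_in_free_zmod)
      then show ?thesis
        using row_Y[OF \<open>v \<in> Y\<close>] by (simp add: old')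
    qed
    then show "x \<in> L"
      unfolding p using p(1) L(1) by (intro frag_extend_mem) (auto simp: free_zmod_def)
  next
    fix x assume "x \<in> L"
    then obtain k where k: "(\<Sum>v\<in>insert a Y. Poly_Mapping.lookup x v) = int c * k"
      using c_dvd by blast
    define z where "z = x - frag_cmul k b"
    have "z \<in> L"
      unfolding z_def using L(1) \<open>x \<in> L\<close> b by (intro zmod.subspace_diff zmod.subspace_scale)
    have "(\<Sum>v\<in>insert a Y. Poly_Mapping.lookup z v) = 0"
      unfolding z_def lookup_minus lookup_frag_cmul sum_subtractf sum_distrib_left[symmetric] k c
      by simp
    then have z_a: "Poly_Mapping.lookup z a = - (\<Sum>v\<in>Y. Poly_Mapping.lookup z v)"
      using fin \<open>a \<notin> Y\<close> by simp
    define y where "y = (\<Sum>v\<in>Y. frag_cmul (Poly_Mapping.lookup z v) (frag_of v))"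
    have "y \<in> free_zmod Y"
      unfolding y_def
      by (intro zmod.subspace_sum zmod.subspace_scale free_zmod_subspace frag_of_in_free_zmod)
    have "\<phi> y = (\<Sum>v\<in>Y. frag_cmul (Poly_Mapping.lookup z v) (frag_of v))
        + frag_cmul (Poly_Mapping.lookup z a) (frag_of a)"
      using fin by (simp add: \<phi>_def y_def frag_extend_sum o_def frag_extend_cmul z_a
          zmod.scale_right_diff_distrib sum_subtractf zmod.scale_sum_left zmod.scale_minus_left)
    also have "\<dots> = (\<Sum>v\<in>insert a Y. frag_cmul (Poly_Mapping.lookup z v) (frag_of v))"
      using fin \<open>a \<notin> Y\<close> by simp
    also have "\<dots> = z"
      using fin L \<open>z \<in> L\<close> by (intro free_zmod_expansion[symmetric]) auto
    finally have "\<phi> y = z" .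
    with \<open>y \<in> free_zmod Y\<close> \<open>z \<in> L\<close> have "y \<in> frag_extend row0 ` free_zmod Y"
      by (simp add: old')
    then obtain p where p: "p \<in> free_zmod Y" "y = frag_extend row0 p"
      by blast
    have "x = frag_extend row (p + frag_cmul k (frag_of a))"
      using \<open>\<phi> y = z\<close> row_extend[OF p(1)]
      by (simp add: p(2) frag_extend_add frag_extend_cmul row_a z_def)
    moreover have "p + frag_cmul k (frag_of a) \<in> free_zmod (insert a Y)"
    proof (intro zmod.subspace_add zmod.subspace_scale free_zmod_subspace frag_of_in_free_zmod)
      show "p \<in> free_zmod (insert a Y)"
        using p(1) by (auto simp: free_zmod_def)
    qed simp
    ultimately show "x \<in> reduced_laplacian_lattice (insert s (insert a Y)) wt' s"
      unfolding lat by blast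
  qed
qed

theorem exists_sandpile_graph_with_lattice:
  assumes "finite X" "s \<notin> X" "submodule_of L (free_zmod X)"
    and "\<And>v. v \<in> X \<Longrightarrow> \<exists>N>0. frag_cmul N (frag_of v) \<in> L"
  shows "\<exists>E wt. sandpile_graph (insert s X) E wt s \<and>
    reduced_laplacian_lattice (insert s X) wt s = L"
  using assms
proof (induction X arbitrary: s L rule: finite_induct)
  case empty
  have free_empty: "free_zmod {} = {0 :: 'a \<Rightarrow>\<^sub>0 int}"
    by (auto simp: free_zmod_def)
  then have "L = {0}"
    using empty by (auto simp: submodule_of_def dest: zmod.subspace_0)
  moreover have "reduced_laplacian_lattice {s} (\<lambda>_ _. 0) s = {0}"
    by (simp add: reduced_laplacian_lattice_def reduced_laplacian_def free_empty)
  moreover have "sandpile_graph {s} {} (\<lambda>_ _. 0) s"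
    by unfold_locales auto
  ultimately show ?case
    by auto
next
  case (insert a Y)
  have L: "zmod.subspace L" "L \<subseteq> free_zmod (insert a Y)"
    using insert.prems by (auto simp: submodule_of_def)
  \<comment> \<open>the part of \<open>L\<close> of coordinate sum \<open>0\<close>, in the coordinates \<open>Y\<close>\<close>
  define L0 where "L0 = {y \<in> free_zmod Y. frag_extend (\<lambda>v. frag_of v - frag_of a) y \<in> L}"
  define h :: "('a \<Rightarrow>\<^sub>0 int) \<Rightarrow> int" where
    "h = (\<lambda>x. \<Sum>v\<in>insert a Y. Poly_Mapping.lookup x v)"

  have "submodule_of L0 (free_zmod Y)"
    using L(1) free_zmod_subspace[of Y]
    by (auto simp: submodule_of_def zmod.subspace_def L0_def frag_extend_add frag_extend_cmul)
  moreover have "\<exists>N>0. frag_cmul N (frag_of v) \<in> L0" if v: "v \<in> Y" for v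
  proof -
    obtain N where N: "N > 0" "frag_cmul N (frag_of v) \<in> L"
      using insert.prems(3)[of v] v by blast
    moreover obtain M where M: "M > 0" "frag_cmul M (frag_of a) \<in> L"
      using insert.prems(3)[of a] by blast
    ultimately have "frag_cmul M (frag_cmul N (frag_of v)) - frag_cmul N (frag_cmul M (frag_of a)) \<in> L"
      by (intro zmod.subspace_diff[OF L(1)] zmod.subspace_scale[OF L(1)] N(2) M(2))
    then have "frag_cmul (N * M) (frag_of v) \<in> L0"
      using v
      by (auto simp: L0_def free_zmod_def frag_extend_cmul zmod.scale_right_diff_distrib mult.commute)
    with N(1) M(1) show ?thesis
      by (intro exI[of _ "N * M"]) auto
  qed
  ultimately obtain E0 wt0 where G0: "sandpile_graph (insert a Y) E0 wt0 a"
    "reduced_laplacian_lattice (insert a Y) wt0 a = L0"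
    using insert.IH[of a L0] insert.hyps by blast

  obtain N where N: "N > 0" "frag_cmul N (frag_of a) \<in> L"
    using insert.prems(3)[of a] by auto
  moreover have "h (frag_cmul N (frag_of a)) = N"
    using insert.hyps by (auto simp: h_def intro!: sum.neutral)
  moreover have "h (x - y) = h x - h y" "h (frag_cmul k x) = k * h x" for x y k
    unfolding h_def lookup_minus lookup_frag_cmul by (auto simp: sum_subtractf sum_distrib_left)
  ultimately obtain w where w: "w \<in> L" "h w > 0" "\<And>x. x \<in> L \<Longrightarrow> h w dvd h x"
    using integral_functional_generator[OF L(1), of h "frag_cmul N (frag_of a)"] by metis
  obtain b where b: "b \<in> L" "h b = h w" "\<And>v. v \<in> Y \<Longrightarrow> Poly_Mapping.lookup b v \<le> 0"
    using exists_nonpositive_off_diagonal[OF insert.hyps L(1) insert.prems(3) w(1)]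
    unfolding h_def by metis

  define wt where "wt = (\<lambda>v u. if v = a
      then if u = s then nat (h w) else if u = a then 0 else nat (- Poly_Mapping.lookup b u)
      else if u = s then 0 else wt0 v u)"
  have "sandpile_graph (insert s (insert a Y))
     {(u, v) \<in> insert s (insert a Y) \<times> insert s (insert a Y). 0 < wt u v} wt s"
    using insert.hyps insert.prems(1) w(2)
    by (intro sandpile_graph_add_sink[OF G0(1), where c = "nat (h w)"]) (auto simp: wt_def)
  moreover have "reduced_laplacian_lattice (insert s (insert a Y)) wt s = L"
    using insert.hyps insert.prems(1) w(2,3) b G0(2)
    by (intro lattice_add_sink[where b = b and c = "nat (h w)" and wt = wt0] L)
       (auto simp: wt_def h_def L0_def)
  ultimately show ?case
    by blast
qed

section \<open>Rational linear algebra\<close>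

definition rat_vec :: "('a \<Rightarrow>\<^sub>0 int) \<Rightarrow> 'a \<Rightarrow> rat" where
  "rat_vec x = (\<lambda>i. of_int (Poly_Mapping.lookup x i))"

text \<open>
  Scalar multiplication is a constant, not an abstraction: the rules inherited from the vector space
  would otherwise rewrite products under every abstraction.
\<close>

definition rat_scale :: "rat \<Rightarrow> ('a \<Rightarrow> rat) \<Rightarrow> 'a \<Rightarrow> rat" where
  "rat_scale q f = (\<lambda>i. q * f i)"

lemma rat_scale_apply [simp]: "rat_scale q f i = q * f i"
  by (simp add: rat_scale_def)

interpretation ratfun: vector_space rat_scale
  by unfold_locales (simp_all add: fun_eq_iff algebra_simps)

lemma rat_vec_simps [simp]:
  "rat_vec 0 = 0"
  "rat_vec (x + y) = rat_vec x + rat_vec y"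
  "rat_vec (frag_cmul k x) = rat_scale (of_int k) (rat_vec x)"
  by (simp_all add: rat_vec_def fun_eq_iff lookup_add)

lemma inj_rat_vec: "inj rat_vec"
  by (intro injI poly_mapping_eqI) (simp add: rat_vec_def fun_eq_iff)

lemma rat_vec_sum: "rat_vec (\<Sum>i\<in>I. f i) = (\<Sum>i\<in>I. rat_vec (f i))"
  by (induction I rule: infinite_finite_induct) simp_all

lemma rat_vec_expansion:
  assumes "finite X" "x \<in> free_zmod X"
  shows "rat_vec x = (\<Sum>i\<in>X. rat_scale (of_int (Poly_Mapping.lookup x i)) (rat_vec (frag_of i)))"
proof -
  have "rat_vec x = (\<Sum>i\<in>X. rat_vec (frag_cmul (Poly_Mapping.lookup x i) (frag_of i)))"
    using free_zmod_expansion[OF assms] rat_vec_sum by metis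
  then show ?thesis
    by (simp only: rat_vec_simps)
qed

lemma rat_mult_int_obtain:
  obtains m k where "m > 0" "of_int m * q = (of_int k :: rat)"
proof -
  obtain a b where "quotient_of q = (a, b)" by fastforce
  then have "b > 0" "q = of_int a / of_int b"
    by (auto dest: quotient_of_denom_pos quotient_of_div)
  then show ?thesis
    using that[of b a] by simp
qed

lemma common_denominator:
  fixes u :: "'b \<Rightarrow> rat"
  assumes "finite S"
  shows "\<exists>D>0. \<exists>k. \<forall>v\<in>S. of_int D * u v = of_int (k v)"
  using assms
proof induction
  case empty
  show ?case by (auto intro: exI[of _ 1])
next
  case (insert x S)
  then obtain D k where D: "D > 0" "\<And>v. v \<in> S \<Longrightarrow> of_int D * u v = of_int (k v)" by auto
  obtain m l where m: "m > 0" "of_int m * u x = (of_int l :: rat)"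
    by (rule rat_mult_int_obtain)
  have "of_int (m * D) * u v = of_int (if v = x then D * l else m * k v)" if "v \<in> insert x S" for v
    using that m(2) D(2)[of v] by (auto simp: mult_ac)
  with m(1) D(1) show ?case
    by (intro exI[of _ "m * D"]) (auto intro!: exI[of _ "\<lambda>v. if v = x then D * l else m * k v"])
qed

text \<open>
  The rational vectors with a positive integral multiple in \<open>L\<close> form a subspace, which therefore
  contains the rational span of \<open>L\<close>.
\<close>

lemma multiple_mem_of_span:
  assumes L: "zmod.subspace L" and "rat_vec x \<in> ratfun.span (rat_vec ` L)"
  shows "\<exists>N>0. frag_cmul N x \<in> L"
proof -
  define S where "S = {f. \<exists>N>0. \<exists>l\<in>L. \<forall>i. of_int N * f i = rat_vec l i}"
  have mem_S: "f \<in> S" if "N > 0" "l \<in> L" "\<And>i. of_int N * f i = rat_vec l i" for f N l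
    unfolding S_def using that by blast
  have S_E: "\<exists>N l. N > 0 \<and> l \<in> L \<and> (\<forall>i. of_int N * f i = rat_vec l i)" if "f \<in> S" for f
    using that unfolding S_def by blast
  have "ratfun.subspace S"
  proof (rule ratfun.subspaceI)
    show "0 \<in> S"
      by (rule mem_S[of 1 0]) (simp_all add: zmod.subspace_0[OF L])
  next
    fix f g assume "f \<in> S" "g \<in> S"
    obtain N l where f: "N > 0" "l \<in> L" "\<And>i. of_int N * f i = rat_vec l i"
      using S_E[OF \<open>f \<in> S\<close>] by blast
    obtain M m where g: "M > 0" "m \<in> L" "\<And>i. of_int M * g i = rat_vec m i"
      using S_E[OF \<open>g \<in> S\<close>] by blast
    show "f + g \<in> S"
    proof (rule mem_S)
      show "N * M > 0"
        using f(1) g(1) by (rule mult_pos_pos)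
      show "frag_cmul M l + frag_cmul N m \<in> L"
        by (rule zmod.subspace_add[OF L zmod.subspace_scale[OF L f(2)] zmod.subspace_scale[OF L g(2)]])
      show "of_int (N * M) * (f + g) i = rat_vec (frag_cmul M l + frag_cmul N m) i" for i
        by (simp add: f(3)[symmetric] g(3)[symmetric] ring_distribs mult_ac)
    qed
  next
    fix q f assume "f \<in> S"
    obtain N l where f: "N > 0" "l \<in> L" "\<And>i. of_int N * f i = rat_vec l i"
      using S_E[OF \<open>f \<in> S\<close>] by blast
    obtain m k where m: "m > 0" "of_int m * q = (of_int k :: rat)"
      by (rule rat_mult_int_obtain)
    show "rat_scale q f \<in> S"
    proof (rule mem_S)
      show "m * N > 0"
        using m(1) f(1) by (rule mult_pos_pos)
      show "frag_cmul k l \<in> L"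
        by (rule zmod.subspace_scale[OF L f(2)])
      show "of_int (m * N) * rat_scale q f i = rat_vec (frag_cmul k l) i" for i
        by (simp add: f(3)[symmetric] m(2)[symmetric] mult_ac)
    qed
  qed
  moreover have "rat_vec ` L \<subseteq> S"
    by (auto intro: mem_S[of 1])
  ultimately have "rat_vec x \<in> S"
    using assms(2) ratfun.span_minimal by blast
  then obtain N l where N: "N > 0" "l \<in> L" "\<And>i. of_int N * rat_vec x i = rat_vec l i"
    using S_E by blast
  then have "rat_vec (frag_cmul N x) = rat_vec l"
    by (simp add: fun_eq_iff)
  then have "frag_cmul N x = l"
    using inj_rat_vec by (blast dest: injD)
  with N show ?thesis
    by blast
qed

text \<open>A rational relation becomes an integral one after clearing denominators.\<close>

lemma independent_rat_vec:
  assumes "zmod.independent B"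
  shows "ratfun.independent (rat_vec ` B)"
  unfolding ratfun.independent_explicit_finite_subsets
proof (intro allI impI)
  fix S u assume S: "S \<subseteq> rat_vec ` B" "finite S" "(\<Sum>v\<in>S. rat_scale (u v) v) = 0"
  obtain T where T: "T \<subseteq> B" "S = rat_vec ` T"
    using S(1) by (auto simp: subset_image_iff)
  have inj: "inj_on rat_vec T"
    using inj_rat_vec by (rule inj_on_subset) simp
  then have "finite T"
    using S(2) T(2) finite_imageD by blast
  obtain D k where D: "D > 0" "\<And>t. t \<in> T \<Longrightarrow> of_int D * u (rat_vec t) = of_int (k t)"
    using common_denominator[OF \<open>finite T\<close>, of "\<lambda>t. u (rat_vec t)"] by auto
  have "rat_vec (\<Sum>t\<in>T. frag_cmul (k t) t) = (\<Sum>t\<in>T. rat_scale (of_int D) (rat_scale (u (rat_vec t)) (rat_vec t)))"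
    unfolding rat_vec_sum
    by (intro sum.cong) (auto simp: D(2)[symmetric])
  also have "\<dots> = rat_scale (of_int D) (\<Sum>v\<in>S. rat_scale (u v) v)"
    unfolding T(2) sum.reindex[OF inj] o_def by (rule ratfun.scale_sum_right[symmetric])
  also have "\<dots> = rat_vec 0"
    using S(3) by (simp add: fun_eq_iff)
  finally have "(\<Sum>t\<in>T. frag_cmul (k t) t) = 0"
    by (rule injD[OF inj_rat_vec])
  with assms T(1) \<open>finite T\<close> have "\<forall>t\<in>T. k t = 0"
    unfolding zmod.dependent_explicit by blast
  then show "\<forall>v\<in>S. u v = 0"
    using D T(2) by fastforce
qed

text \<open>
  A basis vector outside the rational span of \<open>L\<close> would extend \<open>card X\<close> independent vectors of \<open>L\<close> to
  more independent vectors than the dimension of the space allows.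
\<close>

lemma torsion_of_has_rank:
  assumes "finite X" "submodule_of L (free_zmod X)" "has_rank L (card X)" "v \<in> X"
  shows "\<exists>N>0. frag_cmul N (frag_of v) \<in> L"
proof -
  from assms(3) obtain B where B: "B \<subseteq> L" "finite B" "zmod.independent B" "card B = card X"
    by (auto simp: has_rank_def)
  define e :: "'a \<Rightarrow> 'a \<Rightarrow> rat" where "e = (\<lambda>i. rat_vec (frag_of i))"
  have in_span: "rat_vec x \<in> ratfun.span (e ` X)" if "x \<in> free_zmod X" for x
    unfolding rat_vec_expansion[OF assms(1) that] e_def
    by (intro ratfun.span_sum ratfun.span_scale ratfun.span_base imageI)
  have "e v \<in> ratfun.span (rat_vec ` B)"
  proof (rule ccontr)
    assume *: "e v \<notin> ratfun.span (rat_vec ` B)"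
    then have "ratfun.independent (insert (e v) (rat_vec ` B))"
      using B(3) by (intro ratfun.independent_insertI independent_rat_vec)
    moreover have "insert (e v) (rat_vec ` B) \<subseteq> ratfun.span (e ` X)"
      using in_span B(1) assms(2,4) by (auto simp: e_def submodule_of_def frag_of_in_free_zmod)
    ultimately have "card (insert (e v) (rat_vec ` B)) \<le> card (e ` X)"
      using assms(1) by (intro ratfun.independent_span_bound[THEN conjunct2]) auto
    also have "\<dots> \<le> card X"
      using assms(1) by (rule card_image_le)
    finally show False
      using * B(2,4) ratfun.span_base[of "e v" "rat_vec ` B"]
      by (simp add: card_insert_if card_image inj_on_subset[OF inj_rat_vec] split: if_splits)
  qed
  then have "rat_vec (frag_of v) \<in> ratfun.span (rat_vec ` L)"
    using ratfun.span_mono[of "rat_vec ` B" "rat_vec ` L"] B(1) by (auto simp: e_def)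
  with assms(2) show ?thesis
    by (intro multiple_mem_of_span) (auto simp: submodule_of_def)
qed

text \<open>
  The basis vector at \<open>v\<close> is not in the rational span of \<open>L\<close>, so together with a basis of that span it
  is independent, and a linear map can be prescribed as \<open>1\<close> on it and \<open>0\<close> on the span.
\<close>

lemma exists_annihilating_functional:
  assumes "finite X" "submodule_of L (free_zmod X)"
    and "\<not> (\<exists>N>0. frag_cmul N (frag_of v) \<in> L)"
  obtains f :: "'a \<Rightarrow> rat" where "f v \<noteq> 0"
    "\<And>x. x \<in> L \<Longrightarrow> (\<Sum>i\<in>X. f i * of_int (Poly_Mapping.lookup x i)) = 0"
proof -
  define S :: "('a \<Rightarrow> rat) set" where "S = rat_vec ` L"
  define e :: "'a \<Rightarrow> 'a \<Rightarrow> rat" where "e = (\<lambda>i. rat_vec (frag_of i))"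
  have nspan: "e v \<notin> ratfun.span S"
    using multiple_mem_of_span[of L "frag_of v"] assms by (auto simp: S_def e_def submodule_of_def)
  obtain B where B: "B \<subseteq> S" "ratfun.independent B" "S \<subseteq> ratfun.span B"
    using ratfun.maximal_independent_subset .
  have "e v \<notin> ratfun.span B"
    using nspan ratfun.span_mono[OF B(1)] by blast
  then have ind: "ratfun.independent (insert (e v) B)"
    using B(2) by (rule ratfun.independent_insertI)
  interpret V: vector_space_pair "rat_scale :: rat \<Rightarrow> ('a \<Rightarrow> rat) \<Rightarrow> 'a \<Rightarrow> rat" "(*) :: rat \<Rightarrow> rat \<Rightarrow> rat"
    by unfold_locales (simp_all add: algebra_simps)
  obtain g where g: "Vector_Spaces.linear rat_scale (*) g"
    "\<And>x. x \<in> insert (e v) B \<Longrightarrow> g x = (if x = e v then 1 else 0)"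
    using V.linear_independent_extend[OF ind, of "\<lambda>x. if x = e v then 1 else 0"] by blast
  interpret g: Vector_Spaces.linear "rat_scale :: rat \<Rightarrow> ('a \<Rightarrow> rat) \<Rightarrow> 'a \<Rightarrow> rat" "(*)" g
    by fact
  have "g x = 0" if "x \<in> B" for x
    using g(2)[of x] that \<open>e v \<notin> ratfun.span B\<close> ratfun.span_base[of x B] by auto
  then have g0: "g x = 0" if "x \<in> S" for x
    using V.linear_eq_0_on_span[OF g(1), of B x] that B(3) by blast
  show ?thesis
  proof (rule that[of "\<lambda>i. g (e i)"])
    show "g (e v) \<noteq> 0"
      using g(2)[of "e v"] by simp
    show "(\<Sum>i\<in>X. g (e i) * of_int (Poly_Mapping.lookup x i)) = 0" if "x \<in> L" for x
    proof -
      have "x \<in> free_zmod X"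
        using that assms(2) by (auto simp: submodule_of_def)
      then have "g (rat_vec x) = (\<Sum>i\<in>X. of_int (Poly_Mapping.lookup x i) * g (e i))"
        by (subst rat_vec_expansion[OF assms(1)]) (simp_all add: g.sum g.scale e_def)
      then show ?thesis
        using g0[of "rat_vec x"] that by (simp add: S_def rat_vec_def mult.commute)
    qed
  qed
qed

section \<open>Zeros of lattice ideals\<close>

lemma eval_cpoly_superset:
  assumes "finite S" "Poly_Mapping.keys p \<subseteq> S"
  shows "eval_cpoly z p = (\<Sum>u\<in>S. Poly_Mapping.lookup p u *
        (\<Prod>i\<in>Poly_Mapping.keys u. z i ^ Poly_Mapping.lookup u i))"
  unfolding eval_cpoly_def using assms
  by (intro sum.mono_neutral_left) (auto simp: in_keys_iff)

lemma eval_cpoly_0 [simp]: "eval_cpoly z 0 = 0"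
  by (simp add: eval_cpoly_def)

lemma eval_cpoly_add: "eval_cpoly z (p + q) = eval_cpoly z p + eval_cpoly z q"
proof -
  define S where "S = Poly_Mapping.keys p \<union> Poly_Mapping.keys q"
  have S: "finite S" "Poly_Mapping.keys p \<subseteq> S" "Poly_Mapping.keys q \<subseteq> S" "Poly_Mapping.keys (p + q) \<subseteq> S"
    by (auto simp: S_def dest: Poly_Mapping.keys_add[THEN subsetD])
  then show ?thesis
    by (simp add: eval_cpoly_superset[of S] lookup_add algebra_simps sum.distrib)
qed

lemma eval_cpoly_scale: "eval_cpoly z (cpoly_scale c p) = c * eval_cpoly z p"
proof -
  have "Poly_Mapping.keys (cpoly_scale c p) \<subseteq> Poly_Mapping.keys p"
    by (auto simp: in_keys_iff)
  then have "eval_cpoly z (cpoly_scale c p) = (\<Sum>u\<in>Poly_Mapping.keys p. c * Poly_Mapping.lookup p u *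
        (\<Prod>i\<in>Poly_Mapping.keys u. z i ^ Poly_Mapping.lookup u i))"
    by (subst eval_cpoly_superset[of "Poly_Mapping.keys p"]) auto
  then show ?thesis
    by (simp add: eval_cpoly_def sum_distrib_left mult_ac)
qed

lemma eval_cpoly_monomial_diff:
  assumes "finite X" "Poly_Mapping.keys u \<subseteq> X" "Poly_Mapping.keys v \<subseteq> X"
  shows "eval_cpoly z (monomial u - monomial v) =
    (\<Prod>i\<in>X. z i ^ Poly_Mapping.lookup u i) - (\<Prod>i\<in>X. z i ^ Poly_Mapping.lookup v i)"
proof -
  have mono: "eval_cpoly z (monomial w) = (\<Prod>i\<in>X. z i ^ Poly_Mapping.lookup w i)"
    if "Poly_Mapping.keys w \<subseteq> X" for w
    using assms(1) that
    by (auto simp: eval_cpoly_def monomial_def in_keys_iff intro!: prod.mono_neutral_left)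
  have "monomial u - monomial v = monomial u + cpoly_scale (-1) (monomial v)"
    by (simp add: cpoly.scale_minus_left)
  then show ?thesis
    using mono assms by (simp only: eval_cpoly_add eval_cpoly_scale) simp
qed

lemma lookup_int_exponent: "Poly_Mapping.lookup (int_exponent u) i = int (Poly_Mapping.lookup u i)"
  by (simp add: int_exponent_def Poly_Mapping.map.rep_eq when_def)

text \<open>
  If \<open>f\<close> is orthogonal to \<open>L\<close>, then the character \<open>u \<mapsto> exp (t * (f \<bullet> u))\<close> of \<open>\<int>\<^sup>X\<close> is trivial on
  \<open>L\<close>. Its values on the basis vectors are the coordinates of a point at which \<open>x\<^sup>u\<close> and \<open>x\<^sup>v\<close> agree
  whenever \<open>u - v \<in> L\<close>. Varying \<open>t\<close> gives a curve of zeros.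
\<close>

lemma exp_point_in_zero_set:
  fixes f :: "'a \<Rightarrow> real"
  assumes "finite X" and f: "\<And>x. x \<in> L \<Longrightarrow> (\<Sum>i\<in>X. f i * of_int (Poly_Mapping.lookup x i)) = 0"
  shows "restrict (\<lambda>i. of_real (exp (t * f i))) X \<in> zero_set X (lattice_ideal X L)"
proof -
  define z :: "'a \<Rightarrow> complex" where "z = restrict (\<lambda>i. of_real (exp (t * f i))) X"
  have pow: "(\<Prod>i\<in>X. z i ^ Poly_Mapping.lookup u i)
      = of_real (exp (t * (\<Sum>i\<in>X. f i * real (Poly_Mapping.lookup u i))))" for u
    using assms(1)
    by (simp add: z_def exp_sum sum_distrib_left exp_of_nat2_mult mult.assoc[symmetric])
  have "eval_cpoly z p = 0" if "p \<in> lattice_ideal X L" for p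
    using that unfolding lattice_ideal_def
  proof (induction rule: cpoly.span_induct_alt)
    case base
    show ?case by simp
  next
    case (step c x y)
    then obtain u v where uv: "x = monomial u - monomial v" "Poly_Mapping.keys u \<subseteq> X"
      "Poly_Mapping.keys v \<subseteq> X" "int_exponent u - int_exponent v \<in> L"
      by blast
    have "(\<Sum>i\<in>X. f i * real (Poly_Mapping.lookup u i)) - (\<Sum>i\<in>X. f i * real (Poly_Mapping.lookup v i)) = 0"
      using f[OF uv(4)]
      by (simp add: lookup_minus lookup_int_exponent sum_subtractf[symmetric] algebra_simps)
    then have "eval_cpoly z x = 0"
      using uv assms(1) by (simp add: eval_cpoly_monomial_diff[of X] pow)
    with step.IH show ?case
      by (simp add: eval_cpoly_add eval_cpoly_scale)
  qed
  then show ?thesis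
    by (auto simp: zero_set_def z_def)
qed

lemma torsion_of_finite_zero_set:
  assumes "finite X" "submodule_of L (free_zmod X)"
    and fin: "finite (zero_set X (lattice_ideal X L))" and "v \<in> X"
  shows "\<exists>N>0. frag_cmul N (frag_of v) \<in> L"
proof (rule ccontr)
  assume "\<not> ?thesis"
  then obtain f :: "'a \<Rightarrow> rat" where f: "f v \<noteq> 0"
    "\<And>x. x \<in> L \<Longrightarrow> (\<Sum>i\<in>X. f i * of_int (Poly_Mapping.lookup x i)) = 0"
    using exists_annihilating_functional[OF assms(1,2)] by metis
  define z :: "real \<Rightarrow> 'a \<Rightarrow> complex"
    where "z = (\<lambda>t. restrict (\<lambda>i. of_real (exp (t * of_rat (f i)))) X)"
  have orth: "(\<Sum>i\<in>X. (of_rat (f i) :: real) * of_int (Poly_Mapping.lookup x i)) = 0" if "x \<in> L" for x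
    using arg_cong[OF f(2)[OF that], of "of_rat :: rat \<Rightarrow> real"]
    by (simp add: of_rat_sum of_rat_mult)
  have "z t \<in> zero_set X (lattice_ideal X L)" for t
    unfolding z_def using assms(1) orth by (rule exp_point_in_zero_set)
  then have "finite (range z)"
    using fin by (intro finite_subset[of "range z"] image_subsetI)
  moreover have "inj z"
  proof (rule injI)
    fix t t' assume "z t = z t'"
    then have "z t v = z t' v" by (rule fun_cong)
    then show "t = t'"
      using \<open>v \<in> X\<close> f(1) by (simp add: z_def)
  qed
  ultimately show False
    using finite_imageD infinite_UNIV_char_0 by blast
qed

section \<open>Realization of full-rank lattices and of zero-dimensional lattice ideals\<close>

theorem theorem4p11:
  fixes n :: nat
  shows "(\<forall>L :: (nat \<Rightarrow>\<^sub>0 int) set.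
            submodule_of L (free_zmod {1..n}) \<and> has_rank L n \<longrightarrow>
            (\<exists>(V :: nat set) E wt s.
               sandpile_graph V E wt s \<and> card V = n + 1 \<and> V - {s} = {1..n} \<and>
               reduced_laplacian_lattice V wt s = L)) \<and>
         (\<forall>L :: (nat \<Rightarrow>\<^sub>0 int) set.
            submodule_of L (free_zmod {1..n}) \<and>
            finite (zero_set {1..n} (lattice_ideal {1..n} L)) \<longrightarrow>
            (\<exists>(V :: nat set) E wt s.
               sandpile_graph V E wt s \<and> card V = n + 1 \<and> V - {s} = {1..n} \<and>
               lattice_ideal {1..n} L =
               lattice_ideal (V - {s}) (reduced_laplacian_lattice V wt s)))"
proof -
  have graph: "\<exists>(V :: nat set) E wt s. sandpile_graph V E wt s \<and> card V = n + 1 \<and>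
      V - {s} = {1..n} \<and> reduced_laplacian_lattice V wt s = L"
    if L: "submodule_of L (free_zmod {1..n})"
      and tors: "\<And>v. v \<in> {1..n} \<Longrightarrow> \<exists>N>0. frag_cmul N (frag_of v) \<in> L" for L
  proof -
    obtain E wt where "sandpile_graph (insert 0 {1..n}) E wt 0"
      "reduced_laplacian_lattice (insert 0 {1..n}) wt 0 = L"
      using exists_sandpile_graph_with_lattice[of "{1..n}" 0 L] L tors by auto
    then show ?thesis
      by (intro exI[of _ "insert 0 {1..n}"] exI[of _ E] exI[of _ wt] exI[of _ 0]) auto
  qed
  show ?thesis
  proof (intro conjI allI impI)
    fix L :: "(nat \<Rightarrow>\<^sub>0 int) set"
    assume L: "submodule_of L (free_zmod {1..n}) \<and> has_rank L n"
    then show "\<exists>(V :: nat set) E wt s. sandpile_graph V E wt s \<and> card V = n + 1 \<and>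
        V - {s} = {1..n} \<and> reduced_laplacian_lattice V wt s = L"
      by (intro graph torsion_of_has_rank[of "{1..n}"]) auto
  next
    fix L :: "(nat \<Rightarrow>\<^sub>0 int) set"
    assume L: "submodule_of L (free_zmod {1..n}) \<and>
      finite (zero_set {1..n} (lattice_ideal {1..n} L))"
    then have "\<exists>(V :: nat set) E wt s. sandpile_graph V E wt s \<and> card V = n + 1 \<and>
        V - {s} = {1..n} \<and> reduced_laplacian_lattice V wt s = L"
      by (intro graph torsion_of_finite_zero_set[of "{1..n}"]) auto
    then show "\<exists>(V :: nat set) E wt s. sandpile_graph V E wt s \<and> card V = n + 1 \<and>
        V - {s} = {1..n} \<and> lattice_ideal {1..n} L =
        lattice_ideal (V - {s}) (reduced_laplacian_lattice V wt s)"
      by metis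
  qed
qed

end
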